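(* Let $n\in\mathbb{N}$. Let $j:(0,+\infty)\to\mathbb{R}$ be a function which is nonincreasing and not identically equal to zero, and such that $$\lim_{r\to+\infty}r^{n-1}j(r)=0.$$ Suppose that $\Psi:[0,+\infty)\times[0,+\infty)\to\mathbb{R}$ is a Borel measurable function satisfying $$\Psi(u,0)=\Psi(0,v)=0\quad\text{for all }u\ge0,\ v\ge0.$$ Finally assume that for all nonnegative functions $f,g\in L^\infty(\mathbb{R}^n)$ with compact support there holds $$\int_{\mathbb{R}^n}\int_{\mathbb{R}^n}\Psi(f(x),g(y))\,j(|x-y|)\,dx\,dy\le\int_{\mathbb{R}^n}\int_{\mathbb{R}^n}\Psi(f^*(x),g^*(y))\,j(|x-y|)\,dx\,dy.$$ Then $\Psi$ is supermodular, that is, $$\Psi(a+a',b+b')-\Psi(a+a',b)-\Psi(a,b+b')+\Psi(a,b)\ge0\quad\text{for all }a,a',b,b'\in[0,+\infty).$$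
   Context: $dx$, $dy$ denote Lebesgue measure $\mu$ on $\mathbb{R}^n$. For a nonnegative bounded measurable function $f$ with compact support on $\mathbb{R}^n$, $f^*$ is its Schwarz symmetrization (symmetric decreasing rearrangement): the unique lower semicontinuous function on $\mathbb{R}^n$ which is radially symmetric, radially nonincreasing and such that $\mu\{a<f\le b\}=\mu\{a<f^*\le b\}$ for all numbers $\inf f<a<b$.
   Formalization: The inequality of double integrals is taken between finite values: whenever the left side converges absolutely, the right side must too. If the right side may be +∞, the claim fails, e.g. for j(r)=r^{-n-1}. Also f* is required to be nonnegative, so that it is unique. *)

theory Defs
  imports "HOL-Analysis.Analysis"
begin

definition lower_semicontinuous :: "('a::topological_space \<Rightarrow> real) \<Rightarrow> bool" where
  "lower_semicontinuous f \<longleftrightarrow> (\<forall>c. open {x. c < f x})"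

(* The nonnegative functions in L^\<infinity>(R^n) with compact support, each class being given by a
   representative that is bounded, nonnegative and compactly supported pointwise. *)
definition nonneg_bounded_cpt_support :: "('a::euclidean_space \<Rightarrow> real) \<Rightarrow> bool" where
  "nonneg_bounded_cpt_support f \<longleftrightarrow>
     f \<in> borel_measurable lebesgue \<and> (\<forall>x. 0 \<le> f x) \<and> bounded (range f) \<and>
     compact (closure {x. f x \<noteq> 0})"

(* Nonnegativity of fs has to be required: for f of compact support the infimum of f is 0, so the
   equimeasurability condition says nothing about the values fs \<le> 0, and without it fs could take
   arbitrary nonpositive (radially nonincreasing) values outside the ball {fs > 0}. *)
definition is_schwarz_symmetrization ::
    "('a::euclidean_space \<Rightarrow> real) \<Rightarrow> ('a \<Rightarrow> real) \<Rightarrow> bool" where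
  "is_schwarz_symmetrization f fs \<longleftrightarrow>
     (\<forall>x. 0 \<le> fs x) \<and>
     lower_semicontinuous fs \<and>
     (\<forall>x y. norm x = norm y \<longrightarrow> fs x = fs y) \<and>
     (\<forall>x y. norm x \<le> norm y \<longrightarrow> fs y \<le> fs x) \<and>
     (\<forall>a b. (INF x. f x) < a \<and> a < b \<longrightarrow>
        emeasure lebesgue {x. a < f x \<and> f x \<le> b} = emeasure lebesgue {x. a < fs x \<and> fs x \<le> b})"

definition schwarz_symmetrization :: "('a::euclidean_space \<Rightarrow> real) \<Rightarrow> 'a \<Rightarrow> real" where
  "schwarz_symmetrization f = (THE fs. is_schwarz_symmetrization f fs)"

(* The integrand of the double integral, as a function on R^n x R^n, to be integrated with respect
   to Lebesgue measure on the product. The kernel j is only meaningful on (0,\<infinity>); its value at 0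
   enters on the null set x = y only. *)
definition interaction_integrand ::
    "(real \<Rightarrow> real \<Rightarrow> real) \<Rightarrow> (real \<Rightarrow> real) \<Rightarrow> ('a::euclidean_space \<Rightarrow> real) \<Rightarrow> ('a \<Rightarrow> real)
      \<Rightarrow> 'a \<times> 'a \<Rightarrow> real" where
  "interaction_integrand \<Psi> j f g = (\<lambda>(x, y). \<Psi> (f x) (g y) * j (norm (x - y)))"

(* An inequality between two integrals, read as an inequality between finite numbers: whenever the
   left-hand integral converges absolutely, so does the right-hand one, and it is at least as large.
   The implicit value 0 of the Bochner integral of a non-integrable function plays no role here. *)
definition integral_le :: "'a measure \<Rightarrow> ('a \<Rightarrow> real) \<Rightarrow> ('a \<Rightarrow> real) \<Rightarrow> bool" where
  "integral_le M F G \<longleftrightarrow>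
     (integrable M F \<longrightarrow> integrable M G \<and> integral\<^sup>L M F \<le> integral\<^sup>L M G)"

(* \<Psi> is only meaningful on [0,\<infinity>) x [0,\<infinity>). *)
definition supermodular :: "(real \<Rightarrow> real \<Rightarrow> real) \<Rightarrow> bool" where
  "supermodular \<Psi> \<longleftrightarrow>
     (\<forall>a\<ge>0. \<forall>a'\<ge>0. \<forall>b\<ge>0. \<forall>b'\<ge>0.
        \<Psi> (a + a') (b + b') - \<Psi> (a + a') b - \<Psi> a (b + b') + \<Psi> a b \<ge> 0)"

end

theory Submission
  imports Defs
begin

text \<open>
  Test the rearrangement inequality on \<open>f = a 1\<^bsub>B(0,R)\<^esub> + a' 1\<^bsub>B(0,e)\<^esub>\<close> and
  \<open>g = b 1\<^bsub>B(0,R)\<^esub> + b' 1\<^bsub>B(p,e)\<^esub>\<close>: symmetrization leaves \<open>f\<close> unchanged and moves the small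
  ball of \<open>g\<close> to the origin. With \<open>I(A,B)\<close> the integral of \<open>j(|x - y|)\<close> over \<open>A \<times> B\<close> and \<open>\<Delta>\<close> the mixed
  difference of \<open>\<Psi>\<close>, the inequality becomes
  \<open>(\<Psi>(a,b+b') - \<Psi>(a,b)) (I(B\<^sub>R,B(0,e)) - I(B\<^sub>R,B(p,e))) + \<Delta> (I(B\<^sub>e,B(0,e)) - I(B\<^sub>e,B(p,e))) \<ge> 0\<close>.
  The first bracket is at most the mass of \<open>j\<close> in a shell of fixed width at radius about \<open>R\<close>, which
  tends to 0 because \<open>r\<^bsup>n-1\<^esup> j(r)\<close> does; the second is positive for \<open>e\<close> small and \<open>p\<close> far away, since \<open>j\<close>
  decreases to 0 without vanishing. Local integrability of the kernel comes from the same
  inequality: for disjoint balls the left-hand side is finite, so unless \<open>\<Psi>\<close> vanishes the right-hand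
  side is finite too.
\<close>

section \<open>Symmetrization of two-step functions\<close>

text \<open>Equimeasurability only prescribes the measures of bands \<open>a < f x \<le> b\<close>.
  Increasing unions of bands recover the superlevel sets; the offset 1 keeps the band nondegenerate
  also for \<open>k = 0\<close>.\<close>

lemma emeasure_superlevel_eq_SUP:
  fixes F :: "'a::euclidean_space \<Rightarrow> real"
  assumes "lower_semicontinuous F"
  shows "emeasure lebesgue {x. a < F x} = (SUP k::nat. emeasure lebesgue {x. a < F x \<and> F x \<le> a + 1 + real k})"
proof -
  have op: "open {x. c < F x}" for c
    using assms by (simp add: lower_semicontinuous_def)
  have "{x. a < F x \<and> F x \<le> a + 1 + real k} = {x. a < F x} - {x. a + 1 + real k < F x}" for k
    by auto
  then have m: "{x. a < F x \<and> F x \<le> a + 1 + real k} \<in> sets lebesgue" for k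
    using op by (simp add: sets.Diff)
  have "{x. a < F x} = (\<Union>k::nat. {x. a < F x \<and> F x \<le> a + 1 + real k})"
  proof (intro equalityI subsetI)
    fix x assume "x \<in> {x. a < F x}"
    moreover obtain k :: nat where "F x - a - 1 \<le> real k"
      using real_arch_simple by blast
    ultimately show "x \<in> (\<Union>k::nat. {x. a < F x \<and> F x \<le> a + 1 + real k})"
      by (auto intro!: exI[of _ k])
  qed auto
  then show ?thesis
    using m by (subst SUP_emeasure_incseq) (auto simp: incseq_def)
qed

lemma emeasure_ball_strict_mono:
  fixes c :: "'a::euclidean_space"
  assumes "0 \<le> r" "r < s"
  shows "emeasure lborel (ball c r) < emeasure lborel (ball c s)"
  using assms by (auto simp: emeasure_ball intro!: ennreal_lessI mult_strict_left_mono power_strict_mono)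

text \<open>Both sets are centred balls (possibly empty or the whole space), hence nested, and the measure
  decides which one is larger.\<close>

lemma open_radial_subset_if_emeasure_eq:
  fixes S T :: "'a::euclidean_space set"
  assumes T: "open T" "\<And>x y. y \<in> T \<Longrightarrow> norm x \<le> norm y \<Longrightarrow> x \<in> T"
    and S: "\<And>x y. y \<in> S \<Longrightarrow> norm x \<le> norm y \<Longrightarrow> x \<in> S"
    and meas: "emeasure lebesgue T \<le> emeasure lebesgue S"
  shows "T \<subseteq> S"
proof (rule ccontr)
  assume "\<not> T \<subseteq> S"
  then obtain x where x: "x \<in> T" "x \<notin> S" by auto
  then obtain e where e: "e > 0" "cball x e \<subseteq> T"
    using T(1) open_contains_cball by blast
  \<comment> \<open>A unit direction pointing away from the origin, so that \<open>T\<close> reaches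
    out to norm \<open>norm x + e\<close>. At \<open>x = 0\<close>, where \<open>sgn x\<close>
    vanishes, any basis vector serves.\<close>
  obtain u :: 'a where u: "norm u = 1" "norm (x + e *\<^sub>R u) = norm x + e"
  proof (cases "x = 0")
    case True
    obtain b :: 'a where "b \<in> Basis" using nonempty_Basis by blast
    then show ?thesis using that[of b] True e by simp
  next
    case False
    have "x + e *\<^sub>R sgn x = (1 + e / norm x) *\<^sub>R x"
      by (simp add: sgn_div_norm algebra_simps divide_inverse)
    then have "norm (x + e *\<^sub>R sgn x) = \<bar>1 + e / norm x\<bar> * norm x"
      by simp
    also have "\<dots> = norm x + e"
      using False e by (simp add: field_simps)
    finally have "norm (x + e *\<^sub>R sgn x) = norm x + e" .
    then show ?thesis using that[of "sgn x"] False by (simp add: norm_sgn)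
  qed
  have "x + e *\<^sub>R u \<in> T"
    using e u by (auto intro!: subsetD[OF e(2)] simp: dist_norm)
  then have "ball 0 (norm x + e) \<subseteq> T"
    using T(2) u by fastforce
  moreover have "S \<subseteq> ball 0 (norm x + e / 2)"
  proof
    fix y assume "y \<in> S"
    then have "norm y < norm x" using S x by (meson not_le)
    then show "y \<in> ball 0 (norm x + e / 2)" using e by simp
  qed
  moreover have "T \<in> sets lebesgue" using T(1) by simp
  ultimately have "emeasure lebesgue (ball (0::'a) (norm x + e)) \<le> emeasure lebesgue (ball (0::'a) (norm x + e/2))"
    using meas emeasure_mono[of "ball 0 (norm x + e)" T lebesgue]
      emeasure_mono[of S "ball 0 (norm x + e / 2)" lebesgue] by fastforce
  moreover have "emeasure lborel (ball (0::'a) (norm x + e/2)) < emeasure lborel (ball (0::'a) (norm x + e))"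
    using e by (intro emeasure_ball_strict_mono) (auto intro: add_nonneg_nonneg)
  ultimately show False by (simp add: emeasure_completion)
qed

lemma is_schwarz_symmetrizationD:
  assumes "is_schwarz_symmetrization f F"
  shows "0 \<le> F x" "lower_semicontinuous F" "norm x \<le> norm y \<Longrightarrow> F y \<le> F x"
    and "(INF x. f x) < a \<and> a < b \<Longrightarrow>
      emeasure lebesgue {x. a < F x \<and> F x \<le> b} = emeasure lebesgue {x. a < f x \<and> f x \<le> b}"
proof -
  note D = assms[unfolded is_schwarz_symmetrization_def]
  show "0 \<le> F x" by (rule D[THEN conjunct1, rule_format])
  show "lower_semicontinuous F" by (rule D[THEN conjunct2, THEN conjunct1])
  show "norm x \<le> norm y \<Longrightarrow> F y \<le> F x"
    by (rule D[THEN conjunct2, THEN conjunct2, THEN conjunct2, THEN conjunct1, rule_format])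
  show "(INF x. f x) < a \<and> a < b \<Longrightarrow>
      emeasure lebesgue {x. a < F x \<and> F x \<le> b} = emeasure lebesgue {x. a < f x \<and> f x \<le> b}"
    by (rule D[THEN conjunct2, THEN conjunct2, THEN conjunct2, THEN conjunct2, rule_format, symmetric])
qed

text \<open>Superlevel sets at positive levels are open, radial and of equal measure, hence equal,
  and they determine nonnegative functions. The bound on the infimum puts every positive level in
  the range where equimeasurability applies.\<close>

lemma is_schwarz_symmetrization_unique:
  fixes f :: "'a::euclidean_space \<Rightarrow> real"
  assumes F: "is_schwarz_symmetrization f F" and G: "is_schwarz_symmetrization f G"
    and inf: "(INF x. f x) \<le> 0"
  shows "F = G"
proof -
  have superlevel: "open {x. a < H x}"
      "y \<in> {x. a < H x} \<Longrightarrow> norm x \<le> norm y \<Longrightarrow> x \<in> {x. a < H x}"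
    if "is_schwarz_symmetrization f H" for H :: "'a \<Rightarrow> real" and a x y
    using is_schwarz_symmetrizationD(2,3)[OF that] less_le_trans[of a "H y" "H x"]
    by (auto simp: lower_semicontinuous_def)
  have eq: "{x. a < F x} = {x. a < G x}" if "a > 0" for a
  proof -
    have eq_emeasure: "emeasure lebesgue {x. a < F x} = emeasure lebesgue {x. a < G x}"
    proof -
      have "emeasure lebesgue {x. a < F x \<and> F x \<le> a + 1 + real k} =
        emeasure lebesgue {x. a < G x \<and> G x \<le> a + 1 + real k}" for k :: nat
      proof -
        have "(INF x. f x) < a \<and> a < a + 1 + real k" using that inf by linarith
        then show ?thesis
          using is_schwarz_symmetrizationD(4)[OF F] is_schwarz_symmetrizationD(4)[OF G]
          by (simp del: emeasure_completion)
      qed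
      then show ?thesis
        by (simp only: emeasure_superlevel_eq_SUP is_schwarz_symmetrizationD(2)[OF F]
            is_schwarz_symmetrizationD(2)[OF G])
    qed
    show ?thesis
    proof
      show "{x. a < F x} \<subseteq> {x. a < G x}"
        by (rule open_radial_subset_if_emeasure_eq[OF superlevel(1,2)[OF F] superlevel(2)[OF G]])
          (use eq_emeasure in simp_all)
      show "{x. a < G x} \<subseteq> {x. a < F x}"
        by (rule open_radial_subset_if_emeasure_eq[OF superlevel(1,2)[OF G] superlevel(2)[OF F]])
          (use eq_emeasure in simp_all)
    qed
  qed
  have le: "H x \<le> K x" if "\<forall>x. 0 \<le> K x" "\<And>a. a > 0 \<Longrightarrow> {x. a < H x} = {x. a < K x}"
    for H K :: "'a \<Rightarrow> real" and x
  proof (rule ccontr)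
    assume less: "\<not> H x \<le> K x"
    define a where "a = (H x + K x) / 2"
    have "a > 0" "a < H x" "\<not> a < K x"
      using less that(1)[rule_format, of x] by (auto simp: a_def)
    then show False using that(2)[of a] by blast
  qed
  show ?thesis
    using eq is_schwarz_symmetrizationD(1)[OF F] is_schwarz_symmetrizationD(1)[OF G]
    by (intro ext antisym le) auto
qed

section \<open>Two-step functions on nested balls\<close>

definition ball_step :: "real \<Rightarrow> real \<Rightarrow> real \<Rightarrow> 'a::euclidean_space \<Rightarrow> real \<Rightarrow> 'a \<Rightarrow> real" where
  "ball_step \<alpha> R \<beta> p e x = \<alpha> * indicator (ball 0 R) x + \<beta> * indicator (ball p e) x"

lemma ball_step_superlevel:
  assumes "0 \<le> \<alpha>" "0 \<le> \<beta>" "ball p e \<subseteq> ball 0 R"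
  shows "{x. c < ball_step \<alpha> R \<beta> p e x} =
    (if c < 0 then UNIV else if c < \<alpha> then ball 0 R else if c < \<alpha> + \<beta> then ball p e else {})"
  using assms by (auto simp: ball_step_def indicator_def split: if_splits)

lemma nonneg_bounded_cpt_support_ball_step:
  assumes "0 \<le> \<alpha>" "0 \<le> \<beta>" "ball p e \<subseteq> ball 0 R"
  shows "nonneg_bounded_cpt_support (ball_step \<alpha> R \<beta> p e)"
proof -
  have "ball_step \<alpha> R \<beta> p e \<in> borel_measurable borel"
    unfolding ball_step_def by (intro borel_measurable_add borel_measurable_times
        borel_measurable_const borel_measurable_indicator) auto
  then have "ball_step \<alpha> R \<beta> p e \<in> borel_measurable lebesgue"
    by (simp add: measurable_completion)
  moreover have nn: "0 \<le> ball_step \<alpha> R \<beta> p e x" for x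
    using assms by (simp add: ball_step_def)
  moreover have "ball_step \<alpha> R \<beta> p e x \<le> \<alpha> + \<beta>" for x
    using assms by (simp add: ball_step_def indicator_def)
  then have "bounded (range (ball_step \<alpha> R \<beta> p e))"
    using nn by (intro boundedI[of _ "\<alpha> + \<beta>"]) auto
  moreover have "bounded {x. ball_step \<alpha> R \<beta> p e x \<noteq> 0}"
    using assms(3) by (intro bounded_subset[OF bounded_ball[of 0 R]])
      (auto simp: ball_step_def indicator_def split: if_splits)
  ultimately show ?thesis
    by (simp add: nonneg_bounded_cpt_support_def)
qed

text \<open>Moving the small ball to the origin preserves its volume, hence the measure of every
  superlevel set. With \<open>p = 0\<close> this says that a centred two-step function is its own
  symmetrization, so one lemma covers both test functions.\<close>

lemma schwarz_symmetrization_ball_step: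
  fixes p :: "'a::euclidean_space"
  assumes nn: "0 \<le> \<alpha>" "0 \<le> \<beta>" and e: "0 \<le> e" "e \<le> R" and sub: "ball p e \<subseteq> ball 0 R"
  shows "schwarz_symmetrization (ball_step \<alpha> R \<beta> p e) = ball_step \<alpha> R \<beta> 0 e"
proof -
  let ?f = "ball_step \<alpha> R \<beta> p e" and ?F = "ball_step \<alpha> R \<beta> (0::'a) e"
  have sub0: "ball 0 e \<subseteq> ball (0::'a) R" using e by auto
  have nn': "0 \<le> ball_step \<alpha> R \<beta> q e x" for q x :: 'a
    using nn by (simp add: ball_step_def)
  have bdd: "bdd_below (range ?f)"
    using nn' by (auto intro: bdd_belowI[of _ 0])
  have inf0: "0 \<le> (INF x. ?f x)"
    using nn' by (intro cINF_greatest) auto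
  \<comment> \<open>Some point lies outside the large ball, so the infimum is 0 and exactly the
    levels \<open>a > 0\<close> enter the definition.\<close>
  have "\<not> bounded (UNIV :: 'a set)" by simp
  then have "\<not> UNIV \<subseteq> ball (0::'a) R" using bounded_ball bounded_subset by blast
  then obtain z :: 'a where "z \<notin> ball 0 R" by blast
  then have "?f z = 0" using sub by (auto simp: ball_step_def indicator_def)
  then have inf: "(INF x. ?f x) \<le> 0" using cINF_lower[OF bdd, of z] by simp
  \<comment> \<open>Bands are differences of superlevel sets; measures may be subtracted because
    superlevel sets at positive levels have finite measure.\<close>
  have split: "emeasure lebesgue {x. a < ball_step \<alpha> R \<beta> q e x \<and> ball_step \<alpha> R \<beta> q e x \<le> b} =
      emeasure lebesgue {x. a < ball_step \<alpha> R \<beta> q e x} - emeasure lebesgue {x. b < ball_step \<alpha> R \<beta> q e x}"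
    if "0 < a" "a < b" and q: "ball q e \<subseteq> ball 0 R" for a b and q :: 'a
  proof -
    have eq: "{x. a < ball_step \<alpha> R \<beta> q e x \<and> ball_step \<alpha> R \<beta> q e x \<le> b} =
      {x. a < ball_step \<alpha> R \<beta> q e x} - {x. b < ball_step \<alpha> R \<beta> q e x}" by auto
    have "{x. c < ball_step \<alpha> R \<beta> q e x} \<in> fmeasurable lebesgue" if "c > 0" for c
      using that by (simp add: ball_step_superlevel[OF nn q])
    then show ?thesis
      unfolding eq using that
      by (intro emeasure_Diff) (auto intro: fmeasurableD simp: fmeasurableD2[unfolded infinity_ennreal_def] simp del: emeasure_completion)
  qed
  have level: "emeasure lebesgue {x. c < ?f x} = emeasure lebesgue {x. c < ?F x}" for c
    using e by (simp add: ball_step_superlevel[OF nn sub] ball_step_superlevel[OF nn sub0] emeasure_ball)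
  have "is_schwarz_symmetrization ?f ?F"
    unfolding is_schwarz_symmetrization_def lower_semicontinuous_def
  proof (intro conjI allI impI)
    show "open {x. c < ?F x}" for c
      by (simp add: ball_step_superlevel[OF nn sub0])
    show "?F x = ?F y" if "norm x = norm y" for x y
      using that by (simp add: ball_step_def indicator_def)
    show "?F y \<le> ?F x" if "norm x \<le> norm y" for x y
      using that nn by (auto simp: ball_step_def indicator_def)
    show "emeasure lebesgue {x. a < ?f x \<and> ?f x \<le> b} = emeasure lebesgue {x. a < ?F x \<and> ?F x \<le> b}"
      if "(INF x. ?f x) < a \<and> a < b" for a b
      using that inf0 split[of a b p] split[of a b 0] sub sub0 level by simp
  qed (rule nn')
  then show ?thesis
    unfolding schwarz_symmetrization_def
    by (intro the_equality is_schwarz_symmetrization_unique[OF _ _ inf])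
qed

section \<open>Radially decreasing kernels\<close>

text \<open>The value \<open>j 0\<close> is arbitrary, so sign and monotonicity facts about the
  kernel hold only off the diagonal. The diagonal is null because it lies in the hyperplane
  orthogonal to \<open>(b, - b)\<close>.\<close>

lemma AE_off_diagonal: "AE z in (lborel :: ('a::euclidean_space \<times> 'a) measure). fst z \<noteq> snd z"
proof -
  obtain b :: 'a where b: "b \<in> Basis" using nonempty_Basis by blast
  have "negligible {z :: 'a \<times> 'a. (b, - b) \<bullet> z = 0}"
    using b by (intro negligible_hyperplane) (simp add: zero_prod_def nonzero_Basis)
  then have "AE z in lebesgue. z \<notin> {z :: 'a \<times> 'a. (b, - b) \<bullet> z = 0}"
    unfolding negligible_iff_null_sets by (rule AE_not_in)
  then have "AE z in lborel. z \<notin> {z :: 'a \<times> 'a. (b, - b) \<bullet> z = 0}"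
    by (simp only: AE_completion_iff)
  then show ?thesis
    by eventually_elim (auto simp: inner_prod_def)
qed

text \<open>A mean value estimate: after factoring out \<open>x - y\<close>, each of the
  \<open>n\<close> remaining summands is at most \<open>x ^ (n - 1)\<close>.\<close>

lemma power_diff_le:
  fixes x y :: real
  assumes "0 \<le> y" "y \<le> x"
  shows "x ^ n - y ^ n \<le> (x - y) * (real n * x ^ (n - 1))"
proof (cases n)
  case (Suc m)
  have "(\<Sum>p<Suc m. x ^ p * y ^ (m - p)) \<le> (\<Sum>p<Suc m. x ^ m)"
  proof (rule sum_mono)
    fix p assume "p \<in> {..<Suc m}"
    then have "x ^ p * x ^ (m - p) = x ^ m" by (simp flip: power_add)
    then show "x ^ p * y ^ (m - p) \<le> x ^ m"
      using assms by (metis mult_left_mono order_trans power_mono zero_le_power)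
  qed
  then show ?thesis
    unfolding Suc diff_power_eq_sum using assms by (intro mult_left_mono) auto
qed simp

section \<open>Mass and interaction energy of a radial kernel\<close>

locale radial_kernel =
  fixes j :: "real \<Rightarrow> real"
  assumes antimono: "\<And>r s. 0 < r \<Longrightarrow> r \<le> s \<Longrightarrow> j s \<le> j r"
    and nonneg: "\<And>r. 0 < r \<Longrightarrow> 0 \<le> j r"
begin

text \<open>Takes values in \<open>ennreal\<close>, as does \<open>energy\<close>, so that both make
  sense before local integrability of the kernel is established.\<close>

definition ball_mass :: "'a::euclidean_space set \<Rightarrow> ennreal" where
  "ball_mass A = (\<integral>\<^sup>+ z. ennreal (j (norm z)) * indicator A z \<partial>lborel)"

text \<open>The double integral written \<open>I(A,B)\<close> in the introductory outline.\<close>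

definition energy :: "'a::euclidean_space set \<Rightarrow> 'a set \<Rightarrow> ennreal" where
  "energy A B = (\<integral>\<^sup>+ z. ennreal (j (norm (fst z - snd z))) * indicator (A \<times> B) z \<partial>lborel)"

text \<open>The real-valued integrand behind \<open>energy\<close>, since the rearrangement
  hypothesis concerns Bochner integrals.\<close>

definition pair_weight :: "'a::euclidean_space set \<Rightarrow> 'a set \<Rightarrow> 'a \<times> 'a \<Rightarrow> real" where
  "pair_weight A B z = indicator (A \<times> B) z * j (norm (fst z - snd z))"

text \<open>Monotonicity is available only on the positive half-line, so \<open>j\<close> is first
  cut off there. The sign change produces an increasing function, and the origin is treated apart
  because \<open>j 0\<close> is arbitrary.\<close>

lemma measurable_kernel [measurable]: "(\<lambda>z::'a::euclidean_space. j (norm z)) \<in> borel_measurable borel"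
proof -
  have "mono_on {0<..} (\<lambda>r. - j r)"
    using antimono by (auto intro!: mono_onI)
  then have "(\<lambda>r. - j r) \<in> borel_measurable (restrict_space borel {0<..})"
    by (rule borel_measurable_mono_on_fnc)
  then have "(\<lambda>r. indicator {0<..} r *\<^sub>R (- j r)) \<in> borel_measurable borel"
    by (subst (asm) borel_measurable_restrict_space_iff) auto
  then have "(\<lambda>r. - (indicator {0<..} r *\<^sub>R (- j r))) \<in> borel_measurable borel"
    by (rule borel_measurable_uminus)
  then have [measurable]: "(\<lambda>r. indicator {0<..} r * j r) \<in> borel_measurable borel"
    by simp
  have "(\<lambda>z::'a. if z = 0 then j 0 else indicator {0<..} (norm z) * j (norm z)) \<in> borel_measurable borel"
    by measurable
  also have "(\<lambda>z::'a. if z = 0 then j 0 else indicator {0<..} (norm z) * j (norm z)) = (\<lambda>z. j (norm z))"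
    by (auto simp: fun_eq_iff)
  finally show ?thesis .
qed

lemma measurable_kernel_diff [measurable]:
  "(\<lambda>z. j (norm (fst z - snd z))) \<in> borel_measurable (borel :: ('a::euclidean_space \<times> 'a) measure)"
proof -
  have "(\<lambda>z::'a \<times> 'a. fst z - snd z) \<in> borel_measurable borel"
    by (intro borel_measurable_continuous_onI continuous_intros)
  from measurable_compose[OF this measurable_kernel] show ?thesis .
qed

lemma measurable_pair_weight:
  assumes "A \<in> sets borel" "B \<in> sets borel"
  shows "pair_weight A B \<in> borel_measurable (borel :: ('a::euclidean_space \<times> 'a) measure)"
proof -
  have "A \<times> B \<in> sets (borel :: ('a \<times> 'a) measure)"
    using assms by (metis borel_prod pair_measureI)
  then show ?thesis
    unfolding pair_weight_def by measurable
qed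

lemma energy_pair_weight: "energy A B = (\<integral>\<^sup>+ z. ennreal (pair_weight A B z) \<partial>lborel)"
  unfolding energy_def pair_weight_def
proof (rule nn_integral_cong)
  show "ennreal (j (norm (fst z - snd z))) * indicator (A \<times> B) z =
      ennreal (indicator (A \<times> B) z * j (norm (fst z - snd z)))" for z
    by (cases "z \<in> A \<times> B") simp_all
qed

lemma AE_pair_weight_nonneg: "AE z in lborel. 0 \<le> pair_weight A B z"
  using AE_off_diagonal
proof eventually_elim
  case (elim z)
  then have "0 \<le> j (norm (fst z - snd z))" by (intro nonneg) simp
  then show ?case by (simp add: pair_weight_def)
qed

text \<open>Translates integrability in the rearrangement hypothesis into finiteness of an energy.
  Borel measurability allows passing from \<open>lebesgue\<close> to \<open>lborel\<close>, and the
  weight is nonnegative off the null diagonal.\<close>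

lemma integrable_pair_weight_iff:
  fixes A B :: "'a::euclidean_space set"
  assumes "A \<in> sets borel" "B \<in> sets borel"
  shows "integrable lebesgue (pair_weight A B) \<longleftrightarrow> energy A B < \<infinity>"
proof -
  have "energy A B = (\<integral>\<^sup>+ z. ennreal (norm (pair_weight A B z)) \<partial>lborel)"
    unfolding energy_pair_weight
  proof (rule nn_integral_cong_AE)
    show "AE z in lborel. ennreal (pair_weight A B z) = ennreal (norm (pair_weight A B z))"
      using AE_pair_weight_nonneg[of A B] by eventually_elim simp
  qed
  moreover have meas: "pair_weight A B \<in> borel_measurable lborel"
    using measurable_pair_weight[OF assms] by simp
  ultimately show ?thesis
    unfolding integrable_completion[OF meas] by (simp add: integrable_iff_bounded)
qed

lemma integral_pair_weight:
  fixes A B :: "'a::euclidean_space set"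
  assumes "A \<in> sets borel" "B \<in> sets borel"
  shows "integral\<^sup>L lebesgue (pair_weight A B) = enn2real (energy A B)"
proof -
  have meas: "pair_weight A B \<in> borel_measurable lborel"
    using measurable_pair_weight[OF assms] by simp
  show ?thesis
    unfolding integral_completion[OF meas] energy_pair_weight
    by (rule integral_eq_nn_integral[OF meas AE_pair_weight_nonneg])
qed

lemma energy_mono: "A \<subseteq> A' \<Longrightarrow> B \<subseteq> B' \<Longrightarrow> energy A B \<le> energy A' B'"
  unfolding energy_def by (intro nn_integral_mono mult_left_mono) (auto simp: indicator_def)

lemma emeasure_lborel_Times:
  fixes A B :: "'a::euclidean_space set"
  assumes "A \<in> sets borel" "B \<in> sets borel"
  shows "A \<times> B \<in> sets borel" "emeasure lborel (A \<times> B) = emeasure lborel A * emeasure lborel B"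
proof -
  show "A \<times> B \<in> sets borel"
    using assms by (metis borel_prod pair_measureI)
  show "emeasure lborel (A \<times> B) = emeasure lborel A * emeasure lborel B"
    unfolding lborel_prod[symmetric] using assms by (intro lborel.emeasure_pair_measure_Times) auto
qed

text \<open>The bound is demanded at distinct points only, since \<open>j 0\<close> is arbitrary and
  the diagonal is null.\<close>

lemma energy_ge:
  fixes A B :: "'a::euclidean_space set"
  assumes "A \<in> sets borel" "B \<in> sets borel"
    and c: "\<And>x y. x \<in> A \<Longrightarrow> y \<in> B \<Longrightarrow> x \<noteq> y \<Longrightarrow> c \<le> j (norm (x - y))"
  shows "ennreal c * (emeasure lborel A * emeasure lborel B) \<le> energy A B"
proof -
  note T = emeasure_lborel_Times[OF assms(1,2)]
  have "ennreal c * (emeasure lborel A * emeasure lborel B) = (\<integral>\<^sup>+ z. ennreal c * indicator (A \<times> B) z \<partial>lborel)"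
    using T by (simp add: nn_integral_cmult_indicator)
  also have "\<dots> \<le> energy A B"
    unfolding energy_def
  proof (rule nn_integral_mono_AE)
    show "AE z in lborel. ennreal c * indicator (A \<times> B) z \<le>
        ennreal (j (norm (fst z - snd z))) * indicator (A \<times> B) z"
      using AE_off_diagonal
    proof eventually_elim
      case (elim z)
      then show ?case
        using c[of "fst z" "snd z"] by (cases "z \<in> A \<times> B") (auto intro: ennreal_leI)
    qed
  qed
  finally show ?thesis .
qed

lemma energy_le:
  fixes A B :: "'a::euclidean_space set"
  assumes "A \<in> sets borel" "B \<in> sets borel"
    and c: "\<And>x y. x \<in> A \<Longrightarrow> y \<in> B \<Longrightarrow> x \<noteq> y \<Longrightarrow> j (norm (x - y)) \<le> c"
  shows "energy A B \<le> ennreal c * (emeasure lborel A * emeasure lborel B)"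
proof -
  note T = emeasure_lborel_Times[OF assms(1,2)]
  have "energy A B \<le> (\<integral>\<^sup>+ z. ennreal c * indicator (A \<times> B) z \<partial>lborel)"
    unfolding energy_def
  proof (rule nn_integral_mono_AE)
    show "AE z in lborel. ennreal (j (norm (fst z - snd z))) * indicator (A \<times> B) z \<le>
        ennreal c * indicator (A \<times> B) z"
      using AE_off_diagonal
    proof eventually_elim
      case (elim z)
      then show ?case
        using c[of "fst z" "snd z"] by (cases "z \<in> A \<times> B") (auto intro: ennreal_leI)
    qed
  qed
  also have "\<dots> = ennreal c * (emeasure lborel A * emeasure lborel B)"
    using T by (simp add: nn_integral_cmult_indicator)
  finally show ?thesis .
qed

text \<open>Fixing \<open>y\<close> and substituting \<open>x = y + z\<close> turns the inner
  integral into the kernel mass of the translate of \<open>A\<close> by \<open>- y\<close>, which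
  can be compared with masses of centred balls.\<close>

lemma energy_Tonelli:
  fixes A B :: "'a::euclidean_space set"
  assumes A: "A \<in> sets borel" and B: "B \<in> sets borel"
  shows "energy A B =
    (\<integral>\<^sup>+ y. (\<integral>\<^sup>+ z. ennreal (j (norm z)) * indicator A (y + z) \<partial>lborel) * indicator B y \<partial>lborel)"
proof -
  have meas: "(\<lambda>z. ennreal (j (norm (fst z - snd z))) * indicator (A \<times> B) z) \<in> borel_measurable (lborel \<Otimes>\<^sub>M lborel)"
    using emeasure_lborel_Times(1)[OF A B] unfolding lborel_prod by measurable
  have "energy A B = (\<integral>\<^sup>+ y. (\<integral>\<^sup>+ x. ennreal (j (norm (x - y))) * indicator (A \<times> B) (x, y) \<partial>lborel) \<partial>lborel)"
    unfolding energy_def lborel_prod[symmetric] using lborel_pair.nn_integral_snd[OF meas] by simp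
  also have "\<dots> = (\<integral>\<^sup>+ y. (\<integral>\<^sup>+ x. ennreal (j (norm (x - y))) * indicator A x \<partial>lborel) * indicator B y \<partial>lborel)"
    by (intro nn_integral_cong) (auto simp: indicator_def)
  also have "\<dots> = (\<integral>\<^sup>+ y. (\<integral>\<^sup>+ z. ennreal (j (norm z)) * indicator A (y + z) \<partial>lborel) * indicator B y \<partial>lborel)"
  proof (rule nn_integral_cong)
    fix y :: 'a
    have m: "(\<lambda>x::'a. ennreal (j (norm (x - y))) * indicator A x) \<in> borel_measurable borel"
      using A measurable_compose[OF _ measurable_kernel, of "\<lambda>x. x - y" borel] by measurable
    have "(\<integral>\<^sup>+ x. ennreal (j (norm (x - y))) * indicator A x \<partial>lborel) =
      (\<integral>\<^sup>+ z. ennreal (j (norm z)) * indicator A (y + z) \<partial>lborel)"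
      using m by (subst lborel_distr_plus[of y, symmetric], subst nn_integral_distr) auto
    then show "(\<integral>\<^sup>+ x. ennreal (j (norm (x - y))) * indicator A x \<partial>lborel) * indicator B y =
      (\<integral>\<^sup>+ z. ennreal (j (norm z)) * indicator A (y + z) \<partial>lborel) * indicator B y"
      by simp
  qed
  finally show ?thesis .
qed

text \<open>\<open>C\<close> lies in every translate of \<open>A\<close> by \<open>- y\<close> with
  \<open>y\<close> in \<open>B\<close>, so its mass bounds each inner integral from below.\<close>

lemma ball_mass_le_energy:
  fixes A B C :: "'a::euclidean_space set"
  assumes A: "A \<in> sets borel" and B: "B \<in> sets borel" and sub: "\<And>y z. y \<in> B \<Longrightarrow> z \<in> C \<Longrightarrow> y + z \<in> A"
  shows "ball_mass C * emeasure lborel B \<le> energy A B"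
proof -
  have "ball_mass C * emeasure lborel B = (\<integral>\<^sup>+ y. ball_mass C * indicator B y \<partial>lborel)"
    using B by (simp add: nn_integral_cmult_indicator)
  also have "\<dots> \<le> energy A B"
    unfolding energy_Tonelli[OF A B] ball_mass_def
    by (auto intro!: nn_integral_mono simp: indicator_def sub)
  finally show ?thesis .
qed

text \<open>Dually, \<open>C\<close> contains all these translates.\<close>

lemma energy_le_ball_mass:
  fixes A B C :: "'a::euclidean_space set"
  assumes A: "A \<in> sets borel" and B: "B \<in> sets borel" and sub: "\<And>y z. y \<in> B \<Longrightarrow> y + z \<in> A \<Longrightarrow> z \<in> C"
  shows "energy A B \<le> ball_mass C * emeasure lborel B"
proof -
  have "energy A B \<le> (\<integral>\<^sup>+ y. ball_mass C * indicator B y \<partial>lborel)"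
    unfolding energy_Tonelli[OF A B] ball_mass_def
    by (auto intro!: nn_integral_mono simp: indicator_def sub)
  also have "\<dots> = ball_mass C * emeasure lborel B"
    using B by (simp add: nn_integral_cmult_indicator)
  finally show ?thesis .
qed

section \<open>Shell masses and the effect of translating a small set\<close>

lemma ball_mass_shell:
  assumes "0 < s" "s \<le> t"
  shows "ball_mass (ball (0::'a::euclidean_space) t) \<le> ball_mass (ball (0::'a) s) +
    ennreal (j s * (unit_ball_vol (real DIM('a)) * (t ^ DIM('a) - s ^ DIM('a))))"
proof -
  let ?S = "ball (0::'a) t - ball 0 s"
  have "emeasure lborel ?S = emeasure lborel (ball (0::'a) t) - emeasure lborel (ball (0::'a) s)"
    using assms by (intro emeasure_Diff) (auto simp: emeasure_ball)
  also have "\<dots> = ennreal (unit_ball_vol (real DIM('a)) * (t ^ DIM('a) - s ^ DIM('a)))"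
    using assms by (simp add: emeasure_ball ennreal_minus right_diff_distrib)
  finally have S: "emeasure lborel ?S = \<dots>" .
  have "ball_mass (ball (0::'a) t) \<le>
      (\<integral>\<^sup>+ z. ennreal (j (norm z)) * indicator (ball (0::'a) s) z + ennreal (j s) * indicator ?S z \<partial>lborel)"
    unfolding ball_mass_def using assms
    by (auto intro!: nn_integral_mono ennreal_leI antimono simp: indicator_def)
  also have "\<dots> = ball_mass (ball (0::'a) s) + ennreal (j s) * emeasure lborel ?S"
  proof (subst nn_integral_add)
    have [measurable]: "ball (0::'a) s \<in> sets borel" "?S \<in> sets borel"
      by (auto intro: sets.Diff)
    show "(\<lambda>z. ennreal (j (norm z)) * indicator (ball (0::'a) s) z) \<in> borel_measurable lborel"
      by measurable
    show "(\<lambda>z. ennreal (j s) * indicator ?S z) \<in> borel_measurable lborel"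
      by measurable
  qed (auto simp: ball_mass_def nn_integral_cmult_indicator)
  finally show ?thesis
    using assms nonneg[of s] by (simp add: S ennreal_mult' power_mono)
qed

text \<open>A shell of inner radius \<open>s\<close> and fixed width has volume at most of order
  \<open>s ^ (n - 1)\<close>, so the decay hypothesis on \<open>j\<close> makes its kernel mass
  vanish at infinity.\<close>

lemma shell_tendsto_0:
  assumes lim: "((\<lambda>r. r ^ (n - 1) * j r) \<longlongrightarrow> 0) at_top" and c: "0 \<le> c"
  shows "((\<lambda>s. j s * ((s + c) ^ n - s ^ n)) \<longlongrightarrow> 0) at_top"
proof (rule tendsto_sandwich)
  show "\<forall>\<^sub>F s in at_top. 0 \<le> j s * ((s + c) ^ n - s ^ n)"
    using eventually_gt_at_top[of 0]
    by eventually_elim (use c nonneg in \<open>auto intro!: power_mono mult_nonneg_nonneg\<close>)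
  \<comment> \<open>The factor \<open>2 ^ (n - 1)\<close> comes from
    \<open>s + c \<le> 2 * s\<close>, valid for \<open>s > c\<close>.\<close>
  show "\<forall>\<^sub>F s in at_top. j s * ((s + c) ^ n - s ^ n) \<le> (c * real n * 2 ^ (n - 1)) * (s ^ (n - 1) * j s)"
    using eventually_gt_at_top[of c]
  proof eventually_elim
    case (elim s)
    have "(s + c) ^ n - s ^ n \<le> c * (real n * (s + c) ^ (n - 1))"
      using power_diff_le[of s "s + c" n] elim c by simp
    also have "\<dots> \<le> c * (real n * (2 * s) ^ (n - 1))"
      using elim c by (intro mult_left_mono power_mono) auto
    finally have "j s * ((s + c) ^ n - s ^ n) \<le> j s * (c * (real n * (2 * s) ^ (n - 1)))"
      using elim c nonneg[of s] by (intro mult_left_mono) auto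
    then show ?case by (simp add: power_mult_distrib mult_ac)
  qed
  show "((\<lambda>s. (c * real n * 2 ^ (n - 1)) * (s ^ (n - 1) * j s)) \<longlongrightarrow> 0) at_top"
    using tendsto_mult_right_zero[OF lim] .
qed simp

lemma energy_finite:
  fixes A B :: "'a::euclidean_space set"
  assumes "\<And>R. ball_mass (ball (0::'a) R) < \<infinity>"
    and "A \<in> sets borel" "B \<in> sets borel" "bounded A" "bounded B"
  shows "energy A B < \<infinity>"
proof -
  obtain a b where a: "\<And>x. x \<in> A \<Longrightarrow> norm x \<le> a" and b: "\<And>y. y \<in> B \<Longrightarrow> norm y \<le> b"
    using assms(4,5) by (auto simp: bounded_iff)
  have "energy A B \<le> ball_mass (ball (0::'a) (a + b + 1)) * emeasure lborel B"
  proof (rule energy_le_ball_mass[OF assms(2,3)])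
    fix y z assume "y \<in> B" "y + z \<in> A"
    then have "norm ((y + z) - y) \<le> a + b"
      using a b norm_triangle_ineq4[of "y + z" y] by (meson add_mono order_trans)
    then show "z \<in> ball 0 (a + b + 1)" by simp
  qed
  moreover have "emeasure lborel B < \<infinity>"
    using assms(5) by (rule emeasure_bounded_finite)
  ultimately show ?thesis
    using assms(1) by (metis ennreal_mult_less_top infinity_ennreal_def order_le_less_trans)
qed

text \<open>Translating the large ball by less than \<open>c\<close> keeps it between the centred
  balls of radii \<open>R - c\<close> and \<open>R + c\<close>. Both energies therefore lie between
  the masses of these balls times the common measure, and their difference is controlled by a shell
  of width \<open>2 * c\<close>.\<close>

lemma energy_shift_tendsto_0:
  fixes B B' :: "'a::euclidean_space set"
  assumes lim: "((\<lambda>r. r ^ (DIM('a) - 1) * j r) \<longlongrightarrow> 0) at_top"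
    and fin: "\<And>R. ball_mass (ball (0::'a) R) < \<infinity>"
    and B: "B \<in> sets borel" "B \<subseteq> ball 0 c" and B': "B' \<in> sets borel" "B' \<subseteq> ball 0 c"
    and eq: "emeasure lborel B = emeasure lborel B'" and c: "0 \<le> c"
  shows "((\<lambda>R. enn2real (energy (ball 0 R) B) - enn2real (energy (ball 0 R) B')) \<longlongrightarrow> 0) at_top"
proof -
  define m where "m R = enn2real (ball_mass (ball (0::'a) R))" for R
  define V where "V = unit_ball_vol (real DIM('a))"
  define \<mu> where "\<mu> = enn2real (emeasure lborel B)"
  have bounds: "m (R - c) * \<mu> \<le> enn2real (energy (ball 0 R) D)" "enn2real (energy (ball 0 R) D) \<le> m (R + c) * \<mu>"
    if D: "D \<in> sets borel" "D \<subseteq> ball 0 c" "emeasure lborel D = emeasure lborel B" for D :: "'a set" and R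
  proof -
    have bdd: "bounded D" using D(2) bounded_ball bounded_subset by blast
    have "ball_mass (ball (0::'a) (R - c)) * emeasure lborel B \<le> energy (ball 0 R) D"
      unfolding D(3)[symmetric]
    proof (rule ball_mass_le_energy[OF _ D(1)])
      fix y z :: 'a assume "y \<in> D" "z \<in> ball 0 (R - c)"
      then have "norm y < c" "norm z < R - c" using D(2) by auto
      then show "y + z \<in> ball 0 R" using norm_triangle_ineq[of y z] by simp
    qed auto
    moreover have "energy (ball 0 R) D < \<infinity>"
      using D(1) bdd by (intro energy_finite fin) auto
    ultimately show "m (R - c) * \<mu> \<le> enn2real (energy (ball 0 R) D)"
      unfolding m_def \<mu>_def by (simp flip: enn2real_mult add: enn2real_mono)
    have "energy (ball 0 R) D \<le> ball_mass (ball (0::'a) (R + c)) * emeasure lborel B"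
      unfolding D(3)[symmetric]
    proof (rule energy_le_ball_mass[OF _ D(1)])
      fix y z :: 'a assume "y \<in> D" "y + z \<in> ball 0 R"
      then have "norm y < c" "norm (y + z) < R" using D(2) by auto
      then show "z \<in> ball 0 (R + c)" using norm_triangle_ineq4[of "y + z" y] by simp
    qed auto
    moreover have "ball_mass (ball (0::'a) (R + c)) * emeasure lborel B < \<infinity>"
      using fin[of "R + c"] emeasure_bounded_finite[OF bdd] D(3) by (simp add: ennreal_mult_less_top)
    ultimately show "enn2real (energy (ball 0 R) D) \<le> m (R + c) * \<mu>"
      unfolding m_def \<mu>_def by (simp flip: enn2real_mult add: enn2real_mono)
  qed
  have shell: "m (s + 2 * c) - m s \<le> V * (j s * ((s + 2 * c) ^ DIM('a) - s ^ DIM('a)))" if "0 < s" for s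
  proof -
    have nn: "0 \<le> j s * (V * ((s + 2 * c) ^ DIM('a) - s ^ DIM('a)))"
      using that nonneg[of s] c by (auto simp: V_def intro!: mult_nonneg_nonneg power_mono)
    have "ball_mass (ball (0::'a) (s + 2 * c)) \<le> ball_mass (ball (0::'a) s) +
      ennreal (j s * (V * ((s + 2 * c) ^ DIM('a) - s ^ DIM('a))))"
      unfolding V_def using that c by (intro ball_mass_shell) auto
    then have "m (s + 2 * c) \<le> enn2real (ball_mass (ball (0::'a) s) +
      ennreal (j s * (V * ((s + 2 * c) ^ DIM('a) - s ^ DIM('a)))))"
      unfolding m_def using fin[of s] by (intro enn2real_mono) auto
    also have "\<dots> = m s + j s * (V * ((s + 2 * c) ^ DIM('a) - s ^ DIM('a)))"
      unfolding m_def using fin[of s] nn by (subst enn2real_plus) auto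
    finally show ?thesis by (simp add: mult_ac)
  qed
  have "((\<lambda>s. \<mu> * (V * (j s * ((s + 2 * c) ^ DIM('a) - s ^ DIM('a))))) \<longlongrightarrow> 0) at_top"
    using c by (intro tendsto_mult_right_zero shell_tendsto_0[OF lim]) auto
  then have "((\<lambda>s. \<mu> * (m (s + 2 * c) - m s)) \<longlongrightarrow> 0) at_top"
  proof (rule Lim_null_comparison[rotated])
    show "\<forall>\<^sub>F s in at_top. norm (\<mu> * (m (s + 2 * c) - m s)) \<le>
      \<mu> * (V * (j s * ((s + 2 * c) ^ DIM('a) - s ^ DIM('a))))"
      using eventually_gt_at_top[of 0]
    proof eventually_elim
      case (elim s)
      have "ball_mass (ball (0::'a) s) \<le> ball_mass (ball (0::'a) (s + 2 * c))"
        unfolding ball_mass_def using c by (intro nn_integral_mono mult_left_mono indicator_leI) auto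
      then have "m s \<le> m (s + 2 * c)"
        unfolding m_def using fin by (intro enn2real_mono) auto
      then show ?case
        using shell[OF elim] by (auto simp: \<mu>_def abs_mult intro!: mult_left_mono)
    qed
  qed
  moreover have "filterlim (\<lambda>R. R - c) at_top at_top"
    using filterlim_tendsto_add_at_top[OF tendsto_const[of "- c"] filterlim_ident] by simp
  ultimately have "((\<lambda>R. \<mu> * (m (R - c + 2 * c) - m (R - c))) \<longlongrightarrow> 0) at_top"
    by (rule filterlim_compose)
  then have "((\<lambda>R. \<mu> * (m (R + c) - m (R - c))) \<longlongrightarrow> 0) at_top"
    by (simp add: algebra_simps)
  then show ?thesis
  proof (rule Lim_null_comparison[rotated])
    show "\<forall>\<^sub>F R in at_top. norm (enn2real (energy (ball 0 R) B) - enn2real (energy (ball 0 R) B')) \<le>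
      \<mu> * (m (R + c) - m (R - c))"
      using bounds[OF B refl] bounds[OF B' eq[symmetric]]
      by (intro always_eventually allI) (simp add: abs_le_iff algebra_simps, smt (verit))
  qed
qed


section \<open>Testing the rearrangement inequality on two-step functions\<close>

text \<open>Inclusion-exclusion over the nested balls: on each product cell the coefficients
  telescope to the value of \<open>\<Psi>\<close> there, and outside the large ball
  \<open>\<Psi>\<close> vanishes because one argument is 0. The mixed difference is the weight of
  the product of the small balls.\<close>

lemma interaction_integrand_ball_step:
  fixes p q :: "'a::euclidean_space"
  assumes zero: "\<And>u. 0 \<le> u \<Longrightarrow> \<Psi> u 0 = 0" "\<And>v. 0 \<le> v \<Longrightarrow> \<Psi> 0 v = 0"
    and nn: "0 \<le> a" "0 \<le> a'" "0 \<le> b" "0 \<le> b'"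
    and sub: "ball q e \<subseteq> ball 0 R" "ball p e \<subseteq> ball 0 R"
  shows "interaction_integrand \<Psi> j (ball_step a R a' q e) (ball_step b R b' p e) = (\<lambda>z.
    \<Psi> a b * pair_weight (ball 0 R) (ball 0 R) z
    + (\<Psi> (a + a') b - \<Psi> a b) * pair_weight (ball q e) (ball 0 R) z
    + (\<Psi> a (b + b') - \<Psi> a b) * pair_weight (ball 0 R) (ball p e) z
    + (\<Psi> (a + a') (b + b') - \<Psi> (a + a') b - \<Psi> a (b + b') + \<Psi> a b) * pair_weight (ball q e) (ball p e) z)"
proof
  fix z :: "'a \<times> 'a"
  obtain x y where z: "z = (x, y)" by fastforce
  have "x \<in> ball q e \<and> x \<in> ball 0 R \<or> x \<notin> ball q e \<and> x \<in> ball 0 R \<or> x \<notin> ball q e \<and> x \<notin> ball 0 R"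
    using sub(1) by blast
  moreover have "y \<in> ball p e \<and> y \<in> ball 0 R \<or> y \<notin> ball p e \<and> y \<in> ball 0 R \<or> y \<notin> ball p e \<and> y \<notin> ball 0 R"
    using sub(2) by blast
  ultimately show "interaction_integrand \<Psi> j (ball_step a R a' q e) (ball_step b R b' p e) z =
    \<Psi> a b * pair_weight (ball 0 R) (ball 0 R) z
    + (\<Psi> (a + a') b - \<Psi> a b) * pair_weight (ball q e) (ball 0 R) z
    + (\<Psi> a (b + b') - \<Psi> a b) * pair_weight (ball 0 R) (ball p e) z
    + (\<Psi> (a + a') (b + b') - \<Psi> (a + a') b - \<Psi> a (b + b') + \<Psi> a b) * pair_weight (ball q e) (ball p e) z"
    unfolding z interaction_integrand_def ball_step_def pair_weight_def indicator_times
    by (elim disjE conjE) (simp_all add: zero nn algebra_simps del: mem_ball)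
qed

text \<open>Two balls at distance at least 1 have finite energy because the kernel is at most
  \<open>j 1\<close> there. Symmetrization makes them concentric, and
  \<open>\<Psi> a b \<noteq> 0\<close> transfers finiteness to the energy of a centred ball with
  itself.\<close>

lemma ball_mass_finite_if_rearrangement:
  assumes zero: "\<And>u. 0 \<le> u \<Longrightarrow> \<Psi> u 0 = 0" "\<And>v. 0 \<le> v \<Longrightarrow> \<Psi> 0 v = 0"
    and rearrangement: "\<And>f g :: 'a::euclidean_space \<Rightarrow> real.
      nonneg_bounded_cpt_support f \<Longrightarrow> nonneg_bounded_cpt_support g \<Longrightarrow>
      integral_le lebesgue (interaction_integrand \<Psi> j f g)
        (interaction_integrand \<Psi> j (schwarz_symmetrization f) (schwarz_symmetrization g))"
    and ab: "0 \<le> a" "0 \<le> b" "\<Psi> a b \<noteq> 0"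
  shows "ball_mass (ball (0::'a) R) < \<infinity>"
proof -
  \<comment> \<open>Enlarging \<open>R\<close> ensures a positive radius; the bound for
    \<open>R\<close> itself follows by monotonicity.\<close>
  define \<rho> where "\<rho> = \<bar>R\<bar> + 1"
  obtain u :: 'a where u: "u \<in> Basis" using nonempty_Basis by blast
  \<comment> \<open>This keeps the balls of radius \<open>2 * \<rho>\<close> around 0 and
    \<open>p\<close> at distance at least 1; \<open>L\<close> is \<open>norm p + 2 * \<rho>\<close>,
    so that a centred ball contains both.\<close>
  define p where "p = (4 * \<rho> + 1) *\<^sub>R u"
  define L where "L = 6 * \<rho> + 1"
  let ?B = "ball (0::'a) (2 * \<rho>)" and ?Bp = "ball p (2 * \<rho>)"
  have \<rho>: "\<rho> > 0" "R \<le> \<rho>" and p: "norm p = 4 * \<rho> + 1"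
    using u by (auto simp: \<rho>_def p_def)
  have sub: "?B \<subseteq> ball 0 L" "?Bp \<subseteq> ball 0 L"
    using \<rho> p by (auto simp: L_def subset_ball ball_subset_ball_iff)
  \<comment> \<open>The large ball carries height 0, leaving a multiple of the indicator of one
    ball.\<close>
  let ?f = "ball_step 0 L a (0::'a) (2 * \<rho>)"
  let ?g = "\<lambda>q. ball_step 0 L b (q::'a) (2 * \<rho>)"
  have sym: "schwarz_symmetrization ?f = ?f" "schwarz_symmetrization (?g p) = ?g 0"
    using \<rho> sub ab by (auto intro!: schwarz_symmetrization_ball_step simp: L_def)
  have integrand: "interaction_integrand \<Psi> j ?f (?g q) = (\<lambda>z. \<Psi> a b * pair_weight ?B (ball q (2 * \<rho>)) z)"
    if "ball q (2 * \<rho>) \<subseteq> ball 0 L" for q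
    using interaction_integrand_ball_step[of \<Psi> 0 a 0 b 0 "2 * \<rho>" L q] zero ab sub(1) that by simp
  have "integral_le lebesgue (interaction_integrand \<Psi> j ?f (?g p)) (interaction_integrand \<Psi> j ?f (?g 0))"
    using rearrangement[of ?f "?g p"] sym sub ab by (simp add: nonneg_bounded_cpt_support_ball_step)
  then have "integrable lebesgue (pair_weight ?B ?Bp) \<Longrightarrow> integrable lebesgue (pair_weight ?B ?B)"
    using ab(3) unfolding integrand[OF sub(1)] integrand[OF sub(2)] integral_le_def by simp
  then have imp: "energy ?B ?Bp < \<infinity> \<Longrightarrow> energy ?B ?B < \<infinity>"
    by (simp only: integrable_pair_weight_iff[OF borel_open[OF open_ball] borel_open[OF open_ball]])
  have "energy ?B ?Bp \<le> ennreal (j 1) * (emeasure lborel ?B * emeasure lborel ?Bp)"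
  proof (rule energy_le)
    fix x y assume "x \<in> ?B" "y \<in> ?Bp"
    then have "norm x < 2 * \<rho>" "norm (p - y) < 2 * \<rho>"
      by (simp_all add: dist_norm)
    then have "1 \<le> norm (x - y)"
      using p norm_triangle_ineq4[of "x" "x - y"] norm_triangle_ineq[of "p - y" y] by simp
    then show "j (norm (x - y)) \<le> j 1" by (intro antimono) auto
  qed auto
  also have "\<dots> < \<infinity>"
    by (simp add: ennreal_mult_less_top emeasure_bounded_finite[unfolded infinity_ennreal_def])
  finally have fin: "energy ?B ?B < \<infinity>" by (rule imp)
  have pos: "emeasure lborel (ball (0::'a) \<rho>) \<noteq> 0"
    using \<rho> unit_ball_vol_pos[of "real DIM('a)"]
    by (auto simp: emeasure_ball simp del: unit_ball_vol_pos)
  have "ball_mass (ball (0::'a) \<rho>) * emeasure lborel (ball (0::'a) \<rho>) \<le> energy ?B (ball 0 \<rho>)"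
  proof (rule ball_mass_le_energy)
    fix y z :: 'a assume "y \<in> ball 0 \<rho>" "z \<in> ball 0 \<rho>"
    then show "y + z \<in> ?B" using norm_triangle_ineq[of y z] by simp
  qed auto
  also have "\<dots> \<le> energy ?B ?B"
    using \<rho> by (intro energy_mono) auto
  also note fin
  finally have "ball_mass (ball (0::'a) \<rho>) < \<infinity>"
    using pos by (auto simp: ennreal_mult_less_top)
  moreover have "ball_mass (ball (0::'a) R) \<le> ball_mass (ball (0::'a) \<rho>)"
    unfolding ball_mass_def using \<rho> by (intro nn_integral_mono mult_left_mono) (auto simp: indicator_def)
  ultimately show ?thesis by (rule le_less_trans[rotated])
qed

text \<open>Only the terms of the expansion that contain the moving ball of \<open>g\<close> change
  under symmetrization; the other two are finite by \<open>fin\<close> and cancel.\<close>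

lemma ball_step_rearrangement_inequality:
  fixes p :: "'a::euclidean_space"
  assumes zero: "\<And>u. 0 \<le> u \<Longrightarrow> \<Psi> u 0 = 0" "\<And>v. 0 \<le> v \<Longrightarrow> \<Psi> 0 v = 0"
    and rearrangement: "\<And>f g :: 'a \<Rightarrow> real.
      nonneg_bounded_cpt_support f \<Longrightarrow> nonneg_bounded_cpt_support g \<Longrightarrow>
      integral_le lebesgue (interaction_integrand \<Psi> j f g)
        (interaction_integrand \<Psi> j (schwarz_symmetrization f) (schwarz_symmetrization g))"
    and fin: "\<And>R. ball_mass (ball (0::'a) R) < \<infinity>"
    and nn: "0 \<le> a" "0 \<le> a'" "0 \<le> b" "0 \<le> b'"
    and e: "0 \<le> e" and R: "norm p + e \<le> R"
  shows "0 \<le> (\<Psi> a (b + b') - \<Psi> a b) *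
      (enn2real (energy (ball 0 R) (ball (0::'a) e)) - enn2real (energy (ball 0 R) (ball p e)))
    + (\<Psi> (a + a') (b + b') - \<Psi> (a + a') b - \<Psi> a (b + b') + \<Psi> a b) *
      (enn2real (energy (ball 0 e) (ball (0::'a) e)) - enn2real (energy (ball 0 e) (ball p e)))"
proof -
  have le: "e \<le> R" using R norm_ge_zero[of p] by linarith
  have sub: "ball 0 e \<subseteq> ball (0::'a) R" "ball p e \<subseteq> ball 0 R"
    using R le by (auto simp: ball_subset_ball_iff)
  let ?f = "ball_step a R a' (0::'a) e" and ?g = "\<lambda>q. ball_step b R b' (q::'a) e"
  have int: "integrable lebesgue (pair_weight (ball x r) (ball (y::'a) s))" for x y r s
  proof -
    have "energy (ball x r) (ball y s) < \<infinity>"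
      by (rule energy_finite[OF fin]) auto
    then show ?thesis by (subst integrable_pair_weight_iff) auto
  qed
  have integral: "integrable lebesgue (interaction_integrand \<Psi> j ?f (?g q))"
    "integral\<^sup>L lebesgue (interaction_integrand \<Psi> j ?f (?g q)) =
      \<Psi> a b * enn2real (energy (ball 0 R) (ball (0::'a) R))
    + (\<Psi> (a + a') b - \<Psi> a b) * enn2real (energy (ball 0 e) (ball (0::'a) R))
    + (\<Psi> a (b + b') - \<Psi> a b) * enn2real (energy (ball 0 R) (ball q e))
    + (\<Psi> (a + a') (b + b') - \<Psi> (a + a') b - \<Psi> a (b + b') + \<Psi> a b) * enn2real (energy (ball 0 e) (ball q e))"
    if q: "ball q e \<subseteq> ball 0 R" for q
    unfolding interaction_integrand_ball_step[where \<Psi> = \<Psi>, OF zero nn sub(1) q, simplified]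
    by (simp_all add: int integral_pair_weight)
  have "schwarz_symmetrization ?f = ?f" "schwarz_symmetrization (?g p) = ?g 0"
    using e le sub nn by (auto intro!: schwarz_symmetrization_ball_step)
  then have "integral_le lebesgue (interaction_integrand \<Psi> j ?f (?g p)) (interaction_integrand \<Psi> j ?f (?g 0))"
    using rearrangement[of ?f "?g p"] sub nn by (simp add: nonneg_bounded_cpt_support_ball_step)
  then have "integral\<^sup>L lebesgue (interaction_integrand \<Psi> j ?f (?g p)) \<le>
      integral\<^sup>L lebesgue (interaction_integrand \<Psi> j ?f (?g 0))"
    using integral(1)[OF sub(2)] unfolding integral_le_def by blast
  then show ?thesis
    unfolding integral(2)[OF sub(1)] integral(2)[OF sub(2)] by (simp add: right_diff_distrib)
qed

text \<open>Pick radii with \<open>j s < j r\<close>. Inside a ball of radius \<open>r / 2\<close>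
  distances are at most \<open>r\<close>, so the kernel is at least \<open>j r\<close>; shifting one
  ball by \<open>s + r\<close> makes all distances at least \<open>s\<close>, so the kernel is at
  most \<open>j s\<close>.\<close>

lemma energy_strict_decrease:
  assumes lim: "((\<lambda>r. r ^ (n - 1) * j r) \<longlongrightarrow> 0) at_top" and nonzero: "\<exists>r>0. j r \<noteq> 0"
  obtains e and p :: "'a::euclidean_space"
  where "0 < e" "energy (ball 0 e) (ball p e) < energy (ball 0 e) (ball (0::'a) e)"
proof -
  obtain r where r: "r > 0" "j r > 0" using nonzero nonneg by (metis less_eq_real_def)
  \<comment> \<open>Asking for \<open>1 \<le> s\<close> makes the weight \<open>s ^ (n - 1)\<close>
    at least 1, so the bound on the weighted value passes to \<open>j s\<close>.\<close>
  have "\<forall>\<^sub>F s in at_top. s ^ (n - 1) * j s < j r \<and> 1 \<le> s"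
    using order_tendstoD(2)[OF lim r(2)] eventually_ge_at_top[of 1] by (rule eventually_conj)
  then obtain s where s: "s ^ (n - 1) * j s < j r" "1 \<le> s"
    using eventually_happens by fastforce
  have "1 * j s \<le> s ^ (n - 1) * j s"
    using s(2) nonneg[of s] by (intro mult_right_mono one_le_power) auto
  then have less: "j s < j r" using s(1) by simp
  obtain u :: 'a where u: "u \<in> Basis" using nonempty_Basis by blast
  define e where "e = r / 2"
  define p where "p = (s + r) *\<^sub>R u"
  have e: "e > 0" and p: "norm p = s + r" using u r s by (auto simp: e_def p_def)
  define M where "M = emeasure lborel (ball (0::'a) e)"
  have M: "emeasure lborel (ball q e) = M" for q :: 'a
    using e by (simp add: M_def emeasure_ball)
  have M': "M \<noteq> 0" "M < \<infinity>" using e unit_ball_vol_pos[of "real DIM('a)"]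
    by (auto simp: M_def emeasure_ball simp del: unit_ball_vol_pos)
  have "energy (ball 0 e) (ball p e) \<le> ennreal (j s) * (emeasure lborel (ball (0::'a) e) * emeasure lborel (ball p e))"
  proof (rule energy_le)
    fix x y :: 'a assume "x \<in> ball 0 e" "y \<in> ball p e"
    then have "norm x < e" "norm (p - y) < e" by (simp_all add: dist_norm)
    then have "s \<le> norm (x - y)"
      using p norm_triangle_ineq4[of "x" "x - y"] norm_triangle_ineq[of "p - y" y] by (simp add: e_def)
    then show "j (norm (x - y)) \<le> j s" using s by (intro antimono) auto
  qed auto
  also have "\<dots> = ennreal (j s) * (M * M)" by (simp add: M)
  also have "\<dots> < ennreal (j r) * (M * M)"
    using less r(2) M' by (intro ennreal_mult_strict_right_mono) (auto simp: ennreal_less_iff ennreal_mult_less_top zero_less_iff_neq_zero ennreal_lessI)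
  also have "\<dots> = ennreal (j r) * (emeasure lborel (ball (0::'a) e) * emeasure lborel (ball (0::'a) e))"
    by (simp add: M)
  also have "\<dots> \<le> energy (ball (0::'a) e) (ball 0 e)"
  proof (rule energy_ge)
    fix x y :: 'a assume "x \<in> ball 0 e" "y \<in> ball 0 e" "x \<noteq> y"
    then have "norm (x - y) \<le> r" "0 < norm (x - y)"
      using norm_triangle_ineq4[of x y] by (auto simp: e_def)
    then show "j r \<le> j (norm (x - y))" by (intro antimono)
  qed auto
  finally show ?thesis using that e by blast
qed

lemma supermodular_if_rearrangement:
  assumes nonzero: "\<exists>r>0. j r \<noteq> 0"
    and lim: "((\<lambda>r. r ^ (DIM('a) - 1) * j r) \<longlongrightarrow> 0) at_top"
    and zero: "\<And>u. 0 \<le> u \<Longrightarrow> \<Psi> u 0 = 0" "\<And>v. 0 \<le> v \<Longrightarrow> \<Psi> 0 v = 0"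
    and rearrangement: "\<And>f g :: 'a::euclidean_space \<Rightarrow> real.
      nonneg_bounded_cpt_support f \<Longrightarrow> nonneg_bounded_cpt_support g \<Longrightarrow>
      integral_le lebesgue (interaction_integrand \<Psi> j f g)
        (interaction_integrand \<Psi> j (schwarz_symmetrization f) (schwarz_symmetrization g))"
  shows "supermodular \<Psi>"
\<comment> \<open>If \<open>\<Psi>\<close> vanishes on the quadrant it is trivially supermodular;
  otherwise a nonzero value yields local integrability of the kernel.\<close>
proof (cases "\<exists>a\<ge>0. \<exists>b\<ge>0. \<Psi> a b \<noteq> 0")
  case False
  then show ?thesis by (simp add: supermodular_def)
next
  case True
  then have fin: "ball_mass (ball (0::'a) R) < \<infinity>" for R
    using ball_mass_finite_if_rearrangement[OF zero rearrangement] by blast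
  obtain e and p :: 'a where e: "0 < e" and
    less: "energy (ball 0 e) (ball p e) < energy (ball 0 e) (ball (0::'a) e)"
    using energy_strict_decrease[OF lim nonzero] .
  have "energy (ball 0 e) (ball (0::'a) e) < \<infinity>"
    by (intro energy_finite[OF fin]) auto
  then have pos: "0 < enn2real (energy (ball 0 e) (ball (0::'a) e)) - enn2real (energy (ball 0 e) (ball p e))"
    using less by (simp add: enn2real_less_iff order_less_trans)
  show ?thesis
    unfolding supermodular_def
  proof (intro allI impI)
    fix a a' b b' :: real
    assume nn: "0 \<le> a" "0 \<le> a'" "0 \<le> b" "0 \<le> b'"
    let ?\<Delta> = "\<Psi> (a + a') (b + b') - \<Psi> (a + a') b - \<Psi> a (b + b') + \<Psi> a b"
    let ?D = "enn2real (energy (ball 0 e) (ball (0::'a) e)) - enn2real (energy (ball 0 e) (ball p e))"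
    \<comment> \<open>Here \<open>e\<close> and \<open>p\<close> are fixed independently of
      \<open>R\<close> and of the heights. As \<open>R\<close> grows the shift term dies out,
      leaving the mixed difference times the positive constant \<open>?D\<close>.\<close>
    have "((\<lambda>R. (\<Psi> a (b + b') - \<Psi> a b) *
        (enn2real (energy (ball 0 R) (ball (0::'a) e)) - enn2real (energy (ball 0 R) (ball p e)))
        + ?\<Delta> * ?D) \<longlongrightarrow> (\<Psi> a (b + b') - \<Psi> a b) * 0 + ?\<Delta> * ?D) at_top"
      using e by (intro tendsto_intros energy_shift_tendsto_0[OF lim fin, of _ "norm p + e"])
        (auto simp: emeasure_ball ball_subset_ball_iff)
    moreover have "\<forall>\<^sub>F R in at_top. 0 \<le> (\<Psi> a (b + b') - \<Psi> a b) *
        (enn2real (energy (ball 0 R) (ball (0::'a) e)) - enn2real (energy (ball 0 R) (ball p e)))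
        + ?\<Delta> * ?D"
      using eventually_ge_at_top[of "norm p + e"]
    proof eventually_elim
      case (elim R)
      show ?case
        using ball_step_rearrangement_inequality[OF zero rearrangement fin nn less_imp_le[OF e] elim] .
    qed
    ultimately have "0 \<le> (\<Psi> a (b + b') - \<Psi> a b) * 0 + ?\<Delta> * ?D"
      by (rule tendsto_lowerbound) simp
    then show "0 \<le> ?\<Delta>" using pos by (simp add: zero_le_mult_iff)
  qed
qed

end

text \<open>A negative value \<open>j r\<close> would force \<open>s ^ m * j s \<le> j r < 0\<close>
  for all large \<open>s\<close>, contradicting the limit.\<close>

lemma nonneg_if_antimono_tendsto_0:
  fixes j :: "real \<Rightarrow> real"
  assumes antimono: "\<And>r s. 0 < r \<Longrightarrow> r \<le> s \<Longrightarrow> j s \<le> j r"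
    and lim: "((\<lambda>r. r ^ m * j r) \<longlongrightarrow> 0) at_top" and r: "0 < r"
  shows "0 \<le> j r"
proof (rule ccontr)
  assume neg: "\<not> 0 \<le> j r"
  then have "\<forall>\<^sub>F s in at_top. j r < s ^ m * j s \<and> max 1 r \<le> s"
    by (intro eventually_conj order_tendstoD(1)[OF lim] eventually_ge_at_top) simp
  then obtain s where s: "j r < s ^ m * j s" "1 \<le> s" "r \<le> s"
    using eventually_happens by fastforce
  have "j s \<le> j r" using antimono r s(3) .
  moreover have "s ^ m * j s \<le> 1 * j s"
    using s(2) neg \<open>j s \<le> j r\<close> by (intro mult_right_mono_neg one_le_power) auto
  ultimately show False using s(1) by simp
qed

theorem proposition3p2:
  fixes j :: "real \<Rightarrow> real" and \<Psi> :: "real \<Rightarrow> real \<Rightarrow> real"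
  assumes j_nonincreasing: "antimono_on {0<..} j"
    and j_nonzero: "\<exists>r>0. j r \<noteq> 0"
    and j_lim: "((\<lambda>r. r ^ (CARD('n::finite) - 1) * j r) \<longlongrightarrow> 0) at_top"
    and \<Psi>_borel: "(\<lambda>(u, v). \<Psi> u v) \<in> borel_measurable (restrict_space borel ({0..} \<times> {0..}))"
    and \<Psi>_zero: "\<And>u. u \<ge> 0 \<Longrightarrow> \<Psi> u 0 = 0" "\<And>v. v \<ge> 0 \<Longrightarrow> \<Psi> 0 v = 0"
    and rearrangement: "\<And>f g :: real ^ 'n \<Rightarrow> real.
      nonneg_bounded_cpt_support f \<Longrightarrow> nonneg_bounded_cpt_support g \<Longrightarrow>
      integral_le lebesgue (interaction_integrand \<Psi> j f g)
        (interaction_integrand \<Psi> j (schwarz_symmetrization f) (schwarz_symmetrization g))"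
  shows "supermodular \<Psi>"
proof -
  have antimono: "j s \<le> j r" if "0 < r" "r \<le> s" for r s
    using j_nonincreasing that by (auto simp: monotone_on_def)
  interpret radial_kernel j
    using antimono nonneg_if_antimono_tendsto_0[OF antimono j_lim] by unfold_locales
  show ?thesis
    \<comment> \<open>The placeholder defers the limit hypothesis, which is matched only after the
      dimension of \<open>real ^ 'n\<close> is rewritten to \<open>CARD('n)\<close>.\<close>
    using j_nonzero _ \<Psi>_zero rearrangement
    by (rule supermodular_if_rearrangement) (use j_lim in simp)
qed

end
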